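(* Let $\tilde{\epsilon}\ge 0$ and $\epsilon\ge 0$ be prescribed accuracies and let $\hat{i}\in[n]$ be any starting piece. Then (for any $\rho\ge 0$ and every realization of the random choices made by the algorithm) the algorithm $\texttt{ULO}(\hat{i},\tilde{\epsilon},\epsilon)$ described in the context returns a point $x_K\in\mathcal{X}$ such that $$F(x_K)-F^*\le \max\big\{\epsilon,\ \max\{1,|F(x_K)|\}\cdot\tilde{\epsilon}\big\}$$ in $K\le \min\{n,m+1\}$ iterations, each of which involves a finite number of oracle calls. Moreover, $x_K$ is a local optimum of the problem $\min_{x\in\mathcal{X}}F(x)$.
   Context: **Problem.** Let $d,n,m$ be positive integers, $[N]:=\{1,\dots,N\}$, and $\mathcal{X}\subseteq\mathbb{R}^d$. Let $f^{(i)}:\mathbb{R}^d\to\mathbb{R}\cup\{\infty\}$, $i\in[n]$ (the "pieces") and $c^{(j)}:\mathbb{R}^d\to\mathbb{R}$, $j\in[m]$ (the "constraints") be given. Write $\mathrm{dom}\,h:=\{x\in\mathbb{R}^d: h(x)<\infty\}$. For $S\subseteq[m]$ let $\mathcal{D}^{(S)}:=\{x\in\mathbb{R}^d : c^{(j)}(x)\le 0\ \forall j\in S\}$. For nonempty $H\subseteq[n]$ and $S\subseteq[m]$ let $F^{(H,S)}(x):=\min_{i\in H}f^{(i)}(x)$ if $x\in\mathcal{D}^{(S)}$ and $F^{(H,S)}(x):=\infty$ otherwise. Set $F:=F^{([n],[m])}$, $F^*:=\min_{x\in\mathcal{X}}F(x)$, $\nu(H,S):=\min_{x\in\mathcal{X}}F^{(H,S)}(x)$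 and $\nu^{(i)}:=\nu(\{i\},[m])$. **Standing assumptions.** $-\infty<F^*<\infty$. For every nonempty $H\subseteq[n]$ and every $S\subseteq[m]$, an oracle returns the value $\nu(H,S)$ together with a minimizer $x^*(H,S)\in\mathcal{X}\cap\mathcal{D}^{(S)}$, i.e. $\min_{i\in H}f^{(i)}(x^*(H,S))=\nu(H,S)$ (such a minimizer exists); the oracle is deterministic, always returning the same $x^*(H,S)$ for the same $(H,S)$. For every $i\in[n]$, $f^{(i)}$ is continuous and convex on its domain, and $\mathcal{X}\subseteq\mathrm{dom}\,f^{(i)}$. **Notation.** $x^*(i):=x^*(\{i\},[m])$. The set of active constraints at $x^*(i)$ is $\mathcal{C}(i):=\{j\in[m]: c^{(j)}(x^*(i))=0\}$. For $\rho\ge0$ and $x\in\mathcal{X}$, the $\rho$-active set is $\mathcal{A}_\rho(x):=\{i\in[n]: f^{(i)}(x)\le\min_{l\in[n]}f^{(l)}(x)+\rho\}$. **Local optimum.** A point $\hat{x}\in\mathcal{X}$ is a local optimum (local minimum) if $F(\hat{x})<\infty$ and there is $\alpha>0$ such that $F(\hat{x})=\min\{F(x): x\in\mathcal{X},\ \|x-\hat{x}\|_2\le\alpha\}$. **Algorithm $\texttt{ULO}(\hat{i},\tilde{\epsilon},\epsilon)$.** A tolerance $\rho\ge0$ is fixed. Initialize $k=0$, $\hat{i}_0=\hat{i}$, $H_0=S_0=\emptyset$, $\hat{F}_0=\infty$, $\check{F}_0=-\infty$, $x_0$ arbitrary. While $k=0$ or $\hat{F}_k-\check{F}_k>\max\{\epsilon,\max\{1,|\hat{F}_k|\}\cdot\tilde{\epsilon}\}$,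 perform one iteration: 1. $(i_k^*,H_{k+1},\hat{F}_{k+1},x_{k+1})\leftarrow\texttt{phase-(a)}(\hat{i}_k,H_k,\hat{F}_k,x_k)$. 2. $(\hat{i}_{k+1},S_{k+1},\check{F}_{k+1})\leftarrow\texttt{phase-(b)}(i_k^*,S_k,\check{F}_k,H_{k+1})$. 3. If $\check{F}_{k+1}=\hat{F}_{k+1}$, stop and return $x_{k+1}$; otherwise $k\leftarrow k+1$. If the while condition fails, return $x_k$. $K$ denotes the total number of iterations performed, so the returned point is $x_K$. *$\texttt{phase-(a)}(\hat{i},H,\hat{F},x)$:* Set $H_+\leftarrow H$, $V\leftarrow\{\hat{i}\}$, $R\leftarrow\infty$. While $V\ne\emptyset$: draw $\bar{i}$ uniformly at random from $V$; set $\tilde{x}\leftarrow x^*(\bar{i})$ and $H_+\leftarrow H_+\cup\{\bar{i}\}$; if $\nu^{(\bar{i})}\ge R$, set $V\leftarrow V\setminus\{\bar{i}\}$; otherwise set $\bar{x}\leftarrow\tilde{x}$, $V\leftarrow\mathcal{A}_\rho(\bar{x})\setminus H_+$ (with the new $\bar{x}$ and $H_+$), $R\leftarrow F(\tilde{x})$, $i^*\leftarrow\bar{i}$. After the loop, if $F(\bar{x})<\hat{F}$, set $\hat{F}\leftarrow F(\bar{x})$ and $x\leftarrow\bar{x}$. Return $(i^*,H_+,\hat{F},x)$. *$\texttt{phase-(b)}(i^*,S,\check{F},H_+)$:* Draw $\bar{j}$ uniformly at random from $[m]\setminus S$ and set $S_+\leftarrow S\cup\mathcal{C}(i^* )\cup\{\bar{j}\}$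 (if $S=[m]$, no index is drawn and $S_+=[m]$). For $i\in[n]$ let $\check{\nu}^{(i)}:=\nu^{(i)}$ if $i\in H_+$ and $\check{\nu}^{(i)}:=\nu(\{i\},S_+)$ if $i\notin H_+$. Choose $\hat{i}\in\arg\min_{i\in[n]}\check{\nu}^{(i)}$ and set $\check{F}\leftarrow\max\{\check{F},\check{\nu}^{(\hat{i})}\}$. Return $(\hat{i},S_+,\check{F})$. *)

theory Defs
  imports "HOL-Analysis.Analysis"
begin

definition edom :: "('a \<Rightarrow> ereal) \<Rightarrow> 'a set" where
  "edom h = {x. h x < \<infinity>}"

definition feas :: "(nat \<Rightarrow> 'a \<Rightarrow> real) \<Rightarrow> nat set \<Rightarrow> 'a set" where
  "feas c S = {x. \<forall>j\<in>S. c j x \<le> 0}"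

definition Fsub ::
  "(nat \<Rightarrow> 'a \<Rightarrow> ereal) \<Rightarrow> (nat \<Rightarrow> 'a \<Rightarrow> real) \<Rightarrow> nat set \<Rightarrow> nat set \<Rightarrow> 'a \<Rightarrow> ereal" where
  "Fsub f c H S x = (if x \<in> feas c S then (MIN i\<in>H. f i x) else \<infinity>)"

(* The paper writes min; that the infimum is attained is part of the oracle assumption
   (is_oracle below). *)
definition nu ::
  "'a set \<Rightarrow> (nat \<Rightarrow> 'a \<Rightarrow> ereal) \<Rightarrow> (nat \<Rightarrow> 'a \<Rightarrow> real) \<Rightarrow> nat set \<Rightarrow> nat set \<Rightarrow> ereal" where
  "nu X f c H S = (INF x\<in>X. Fsub f c H S x)"

(* The oracle answers the query (H, S) with the value nu X f c H S and the point xs H S.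
   It is deterministic because xs is a function. *)
definition is_oracle ::
  "nat \<Rightarrow> nat \<Rightarrow> 'a set \<Rightarrow> (nat \<Rightarrow> 'a \<Rightarrow> ereal) \<Rightarrow> (nat \<Rightarrow> 'a \<Rightarrow> real)
    \<Rightarrow> (nat set \<Rightarrow> nat set \<Rightarrow> 'a) \<Rightarrow> bool" where
  "is_oracle n m X f c xs \<longleftrightarrow>
     (\<forall>H S. H \<noteq> {} \<longrightarrow> H \<subseteq> {1..n} \<longrightarrow> S \<subseteq> {1..m} \<longrightarrow>
        xs H S \<in> X \<inter> feas c S \<and> (MIN i\<in>H. f i (xs H S)) = nu X f c H S)"

definition active_constraints ::
  "nat \<Rightarrow> (nat \<Rightarrow> 'a \<Rightarrow> real) \<Rightarrow> (nat set \<Rightarrow> nat set \<Rightarrow> 'a) \<Rightarrow> nat \<Rightarrow> nat set" where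
  "active_constraints m c xs i = {j \<in> {1..m}. c j (xs {i} {1..m}) = 0}"

definition rho_active :: "nat \<Rightarrow> (nat \<Rightarrow> 'a \<Rightarrow> ereal) \<Rightarrow> real \<Rightarrow> 'a \<Rightarrow> nat set" where
  "rho_active n f \<rho> x = {i \<in> {1..n}. f i x \<le> (MIN l\<in>{1..n}. f l x) + ereal \<rho>}"

(* The infimum is a minimum: it is over a set containing x0 itself. *)
definition local_opt :: "'a::real_normed_vector set \<Rightarrow> ('a \<Rightarrow> ereal) \<Rightarrow> 'a \<Rightarrow> bool" where
  "local_opt X F x0 \<longleftrightarrow> x0 \<in> X \<and> F x0 < \<infinity> \<and>
     (\<exists>\<alpha>>0. F x0 = (INF x\<in>{x \<in> X. norm (x - x0) \<le> \<alpha>}. F x))"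

datatype ulo_loc = LoopTest | PhaseA | PhaseB | Returned

(* st_k to st_x are the variables of the main loop; after the program has returned, st_k is
   the number of iterations performed and st_x the returned point. The fields from st_Hp on
   are the local variables of phase (a): H_+, V, R, bar x, i^*. *)
record 'a ulo_state =
  st_loc :: ulo_loc
  st_k :: nat
  st_i :: nat
  st_H :: "nat set"
  st_S :: "nat set"
  st_Fhat :: ereal
  st_Fchk :: ereal
  st_x :: 'a
  st_Hp :: "nat set"
  st_V :: "nat set"
  st_R :: ereal
  st_xbar :: 'a
  st_istar :: nat

definition ulo_init :: "nat \<Rightarrow> 'a \<Rightarrow> 'a ulo_state" where
  "ulo_init i0 x0 =
     \<lparr>st_loc = LoopTest, st_k = 0, st_i = i0, st_H = {}, st_S = {},
      st_Fhat = \<infinity>, st_Fchk = -\<infinity>, st_x = x0,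
      st_Hp = {}, st_V = {}, st_R = \<infinity>, st_xbar = undefined, st_istar = undefined\<rparr>"

(* In the step functions, "draw A" is the element drawn at random from A, and "tie A" the
   element chosen from a set A of minimisers. *)

definition test_step :: "real \<Rightarrow> real \<Rightarrow> 'a ulo_state \<Rightarrow> 'a ulo_state" where
  "test_step epst eps s =
     (if st_k s = 0 \<or>
         st_Fhat s - st_Fchk s > max (ereal eps) (max 1 \<bar>st_Fhat s\<bar> * ereal epst)
      then s\<lparr>st_loc := PhaseA, st_Hp := st_H s, st_V := {st_i s}, st_R := \<infinity>,
             st_xbar := undefined, st_istar := undefined\<rparr>
      else s\<lparr>st_loc := Returned\<rparr>)"

(* One pass through the loop of phase (a), or, if V is empty, the exit from phase (a). *)
definition phaseA_step ::
  "nat \<Rightarrow> nat \<Rightarrow> 'a set \<Rightarrow> (nat \<Rightarrow> 'a \<Rightarrow> ereal) \<Rightarrow> (nat \<Rightarrow> 'a \<Rightarrow> real)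
    \<Rightarrow> (nat set \<Rightarrow> nat set \<Rightarrow> 'a) \<Rightarrow> real \<Rightarrow> (nat set \<Rightarrow> nat) \<Rightarrow> 'a ulo_state \<Rightarrow> 'a ulo_state" where
  "phaseA_step n m X f c xs \<rho> draw s =
     (let F = Fsub f c {1..n} {1..m} in
      if st_V s \<noteq> {} then
        let i = draw (st_V s); xt = xs {i} {1..m}; Hp = insert i (st_Hp s) in
        if nu X f c {i} {1..m} \<ge> st_R s
        then s\<lparr>st_Hp := Hp, st_V := st_V s - {i}\<rparr>
        else s\<lparr>st_Hp := Hp, st_V := rho_active n f \<rho> xt - Hp, st_R := F xt,
               st_xbar := xt, st_istar := i\<rparr>
      else if F (st_xbar s) < st_Fhat s
      then s\<lparr>st_loc := PhaseB, st_H := st_Hp s, st_Fhat := F (st_xbar s), st_x := st_xbar s\<rparr>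
      else s\<lparr>st_loc := PhaseB, st_H := st_Hp s\<rparr>)"

definition S_plus ::
  "nat \<Rightarrow> (nat \<Rightarrow> 'a \<Rightarrow> real) \<Rightarrow> (nat set \<Rightarrow> nat set \<Rightarrow> 'a) \<Rightarrow> (nat set \<Rightarrow> nat)
    \<Rightarrow> 'a ulo_state \<Rightarrow> nat set" where
  "S_plus m c xs draw s =
     (if st_S s = {1..m} then {1..m}
      else st_S s \<union> active_constraints m c xs (st_istar s) \<union> {draw ({1..m} - st_S s)})"

definition phaseB_step ::
  "nat \<Rightarrow> nat \<Rightarrow> 'a set \<Rightarrow> (nat \<Rightarrow> 'a \<Rightarrow> ereal) \<Rightarrow> (nat \<Rightarrow> 'a \<Rightarrow> real)
    \<Rightarrow> (nat set \<Rightarrow> nat set \<Rightarrow> 'a) \<Rightarrow> (nat set \<Rightarrow> nat) \<Rightarrow> (nat set \<Rightarrow> nat)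
    \<Rightarrow> 'a ulo_state \<Rightarrow> 'a ulo_state" where
  "phaseB_step n m X f c xs draw tie s =
     (let Sp = S_plus m c xs draw s;
          nuchk = (\<lambda>i. if i \<in> st_H s then nu X f c {i} {1..m} else nu X f c {i} Sp);
          i = tie {i. is_arg_min nuchk (\<lambda>l. l \<in> {1..n}) i};
          Fchk = max (st_Fchk s) (nuchk i)
      in s\<lparr>st_loc := (if Fchk = st_Fhat s then Returned else LoopTest),
           st_k := Suc (st_k s), st_i := i, st_S := Sp, st_Fchk := Fchk\<rparr>)"

definition ulo_step ::
  "nat \<Rightarrow> nat \<Rightarrow> 'a set \<Rightarrow> (nat \<Rightarrow> 'a \<Rightarrow> ereal) \<Rightarrow> (nat \<Rightarrow> 'a \<Rightarrow> real)
    \<Rightarrow> (nat set \<Rightarrow> nat set \<Rightarrow> 'a) \<Rightarrow> real \<Rightarrow> real \<Rightarrow> real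
    \<Rightarrow> (nat set \<Rightarrow> nat) \<Rightarrow> (nat set \<Rightarrow> nat) \<Rightarrow> 'a ulo_state \<Rightarrow> 'a ulo_state" where
  "ulo_step n m X f c xs \<rho> epst eps draw tie s =
     (case st_loc s of
        LoopTest \<Rightarrow> test_step epst eps s
      | PhaseA \<Rightarrow> phaseA_step n m X f c xs \<rho> draw s
      | PhaseB \<Rightarrow> phaseB_step n m X f c xs draw tie s
      | Returned \<Rightarrow> s)"

(* The oracle queries (H, S) made by ulo_step in state s. *)
definition oracle_queries ::
  "nat \<Rightarrow> nat \<Rightarrow> (nat \<Rightarrow> 'a \<Rightarrow> real) \<Rightarrow> (nat set \<Rightarrow> nat set \<Rightarrow> 'a) \<Rightarrow> (nat set \<Rightarrow> nat)
    \<Rightarrow> 'a ulo_state \<Rightarrow> (nat set \<times> nat set) set" where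
  "oracle_queries n m c xs draw s =
     (case st_loc s of
        PhaseA \<Rightarrow> (if st_V s \<noteq> {} then {({draw (st_V s)}, {1..m})} else {})
      | PhaseB \<Rightarrow> {({i}, if i \<in> st_H s then {1..m} else S_plus m c xs draw s) | i. i \<in> {1..n}}
      | _ \<Rightarrow> {})"

(* A realization of the choices: at time t the element chosen from a nonempty set A is g t A.
   Since g may depend on t arbitrarily, every sequence of choices is of this form. *)
definition choice_seq :: "(nat \<Rightarrow> nat set \<Rightarrow> nat) \<Rightarrow> bool" where
  "choice_seq g \<longleftrightarrow> (\<forall>t A. A \<noteq> {} \<longrightarrow> g t A \<in> A)"

(* The state of ULO(i0, epst, eps) after t steps. *)
primrec ulo_run ::
  "nat \<Rightarrow> nat \<Rightarrow> 'a set \<Rightarrow> (nat \<Rightarrow> 'a \<Rightarrow> ereal) \<Rightarrow> (nat \<Rightarrow> 'a \<Rightarrow> real)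
    \<Rightarrow> (nat set \<Rightarrow> nat set \<Rightarrow> 'a) \<Rightarrow> real \<Rightarrow> real \<Rightarrow> real
    \<Rightarrow> (nat \<Rightarrow> nat set \<Rightarrow> nat) \<Rightarrow> (nat \<Rightarrow> nat set \<Rightarrow> nat) \<Rightarrow> nat \<Rightarrow> 'a \<Rightarrow> nat \<Rightarrow> 'a ulo_state" where
  "ulo_run n m X f c xs \<rho> epst eps draw tie i0 x0 0 = ulo_init i0 x0"
| "ulo_run n m X f c xs \<rho> epst eps draw tie i0 x0 (Suc t) =
     ulo_step n m X f c xs \<rho> epst eps (draw t) (tie t)
       (ulo_run n m X f c xs \<rho> epst eps draw tie i0 x0 t)"

(* The oracle calls made during iteration k (counted from 0), each tagged with its time, so
   that repeated queries count as separate calls. *)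
definition oracle_calls ::
  "nat \<Rightarrow> nat \<Rightarrow> (nat \<Rightarrow> 'a \<Rightarrow> real) \<Rightarrow> (nat set \<Rightarrow> nat set \<Rightarrow> 'a)
    \<Rightarrow> (nat \<Rightarrow> nat set \<Rightarrow> nat) \<Rightarrow> (nat \<Rightarrow> 'a ulo_state) \<Rightarrow> nat
    \<Rightarrow> (nat \<times> nat set \<times> nat set) set" where
  "oracle_calls n m c xs draw \<sigma> k =
     {(t, q). st_k (\<sigma> t) = k \<and> q \<in> oracle_queries n m c xs (draw t) (\<sigma> t)}"

end

theory Submission
  imports Defs
begin

text \<open>
  Write \<open>\<nu> i\<close> for the minimum of piece \<open>i\<close>, and \<open>Fhat\<close>, \<open>Fchk\<close> for the upper and the lower bound.
  Every processed piece \<open>i\<close> satisfies \<open>\<nu> i \<ge> F x\<close> for the current incumbent \<open>x\<close>, since the values \<open>R\<close>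
  in phase (a), and then \<open>Fhat\<close>, only decrease. At the end of phase (a) all pieces active at the
  incumbent are processed, so no active piece goes below \<open>F x\<close> on the feasible set, and by
  continuity no inactive piece does so near \<open>x\<close>.
  Since \<open>Fchk \<le> Fstar \<le> Fhat\<close>, a processed piece chosen in phase (b) closes the gap; hence each
  further iteration processes a new piece, which gives \<open>K \<le> n\<close>. Each iteration also enlarges \<open>S\<close>;
  once \<open>S = {1..m}\<close> the chosen piece attains \<open>Fstar\<close>, and the next iteration closes the gap, which
  gives \<open>K \<le> m + 1\<close>.
\<close>

section \<open>Minima of the pieces and local optimality\<close>

locale ulo_problem =
  fixes n m :: nat and X :: "'a::real_normed_vector set"
    and f :: "nat \<Rightarrow> 'a \<Rightarrow> ereal" and c :: "nat \<Rightarrow> 'a \<Rightarrow> real"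
    and xs :: "nat set \<Rightarrow> nat set \<Rightarrow> 'a"
  assumes n_pos: "n \<ge> 1" and m_pos: "m \<ge> 1"
    and f_not_MInf: "\<And>i x. i \<in> {1..n} \<Longrightarrow> f i x \<noteq> -\<infinity>"
    and xs_oracle: "is_oracle n m X f c xs"
    and f_cont: "\<And>i. i \<in> {1..n} \<Longrightarrow> continuous_on (edom (f i)) (f i)"
    and X_dom: "\<And>i. i \<in> {1..n} \<Longrightarrow> X \<subseteq> edom (f i)"
begin

abbreviation F :: "'a \<Rightarrow> ereal" where
  "F \<equiv> Fsub f c {1..n} {1..m}"

abbreviation Fstar :: ereal where
  "Fstar \<equiv> nu X f c {1..n} {1..m}"

abbreviation piece_min :: "nat \<Rightarrow> ereal" where
  "piece_min i \<equiv> nu X f c {i} {1..m}"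

abbreviation piece_argmin :: "nat \<Rightarrow> 'a" where
  "piece_argmin i \<equiv> xs {i} {1..m}"

lemma f_finite: "i \<in> {1..n} \<Longrightarrow> x \<in> X \<Longrightarrow> \<bar>f i x\<bar> \<noteq> \<infinity>"
  using f_not_MInf[of i x] X_dom[of i] by (auto simp: edom_def)

lemma F_le: "x \<in> feas c {1..m} \<Longrightarrow> i \<in> {1..n} \<Longrightarrow> F x \<le> f i x"
  by (auto simp: Fsub_def intro!: Min_le)

lemma F_attained:
  assumes "x \<in> feas c {1..m}"
  obtains i where "i \<in> {1..n}" "F x = f i x"
proof -
  have "(MIN i\<in>{1..n}. f i x) \<in> (\<lambda>i. f i x) ` {1..n}"
    using n_pos by (intro Min_in) auto
  then show ?thesis using assms that by (auto simp: Fsub_def)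
qed

lemma F_finite: "x \<in> X \<Longrightarrow> x \<in> feas c {1..m} \<Longrightarrow> \<bar>F x\<bar> \<noteq> \<infinity>"
  by (metis F_attained f_finite)

lemma piece_argmin_in:
  assumes "i \<in> {1..n}"
  shows "piece_argmin i \<in> X" "piece_argmin i \<in> feas c {1..m}"
    and "f i (piece_argmin i) = piece_min i"
  using xs_oracle assms unfolding is_oracle_def
  by (auto dest: spec[of _ "{i}"])

lemma piece_min_finite: "i \<in> {1..n} \<Longrightarrow> \<bar>piece_min i\<bar> \<noteq> \<infinity>"
  by (metis piece_argmin_in f_finite)

lemma F_piece_argmin_le: "i \<in> {1..n} \<Longrightarrow> F (piece_argmin i) \<le> piece_min i"
  by (metis piece_argmin_in F_le)

lemma piece_min_le:
  assumes "i \<in> {1..n}" "x \<in> X" "x \<in> feas c {1..m}"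
  shows "piece_min i \<le> f i x"
proof -
  have "piece_min i \<le> Fsub f c {i} {1..m} x"
    unfolding nu_def using assms by (intro INF_lower) auto
  then show ?thesis using assms by (simp add: Fsub_def)
qed

lemma Fstar_le: "x \<in> X \<Longrightarrow> Fstar \<le> F x"
  unfolding nu_def by (rule INF_lower)

lemma Fstar_le_piece_min: "i \<in> {1..n} \<Longrightarrow> Fstar \<le> piece_min i"
  by (meson Fstar_le F_piece_argmin_le order_trans piece_argmin_in(1))

text \<open>At the minimizer of \<open>F\<close> supplied by the oracle some piece takes the value
  \<open>Fstar\<close>, so its own minimum is no larger.\<close>

lemma Fstar_attained:
  obtains i where "i \<in> {1..n}" "piece_min i \<le> Fstar"
proof -
  define x where "x = xs {1..n} {1..m}"
  have x: "x \<in> X" "x \<in> feas c {1..m}" "(MIN i\<in>{1..n}. f i x) = Fstar"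
    using xs_oracle n_pos unfolding is_oracle_def x_def by auto
  then have "F x = Fstar" by (simp add: Fsub_def)
  then show ?thesis
    using x F_attained piece_min_le that by metis
qed

text \<open>Dropping constraints enlarges the feasible set. This makes the estimates of phase (b)
  lower bounds on the true minima of the pieces.\<close>

lemma nu_singleton_mono:
  assumes "S \<subseteq> {1..m}"
  shows "nu X f c {i} S \<le> piece_min i"
  unfolding nu_def
proof (rule INF_mono)
  fix x assume "x \<in> X"
  moreover have "Fsub f c {i} S x \<le> Fsub f c {i} {1..m} x"
    using assms by (auto simp: Fsub_def feas_def)
  ultimately show "\<exists>y\<in>X. Fsub f c {i} S y \<le> Fsub f c {i} {1..m} x" by blast
qed

text \<open>The neighbourhood comes from the inactive pieces, of which there are finitely many; for
  active pieces the bound holds at all feasible points of \<open>X\<close>.\<close>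

lemma local_opt_if_active_ge:
  assumes x0: "x0 \<in> X" "x0 \<in> feas c {1..m}" and "\<rho> \<ge> 0"
    and active: "\<And>i. i \<in> rho_active n f \<rho> x0 \<Longrightarrow> F x0 \<le> piece_min i"
  shows "local_opt X F x0"
proof -
  have fin: "\<bar>F x0\<bar> \<noteq> \<infinity>" using x0 by (rule F_finite)
  have "\<forall>\<^sub>F x in at x0 within X. x \<in> feas c {1..m} \<longrightarrow> F x0 \<le> f i x" if i: "i \<in> {1..n}" for i
  proof (cases "i \<in> rho_active n f \<rho> x0")
    case True
    then show ?thesis
      using active piece_min_le i
      by (auto simp: eventually_at_filter intro!: always_eventually) (meson order_trans i)
  next
    case False
    then have "F x0 + ereal \<rho> < f i x0"
      using i x0 by (auto simp: rho_active_def Fsub_def)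
    moreover have "F x0 \<le> F x0 + ereal \<rho>"
      using \<open>\<rho> \<ge> 0\<close> by (simp add: add_increasing2)
    ultimately have "F x0 < f i x0" by order
    moreover have "(f i \<longlongrightarrow> f i x0) (at x0 within X)"
      using continuous_on_subset[OF f_cont X_dom, OF i i] x0 by (auto simp: continuous_on_def)
    ultimately have "\<forall>\<^sub>F x in at x0 within X. F x0 < f i x"
      by (simp add: order_tendstoD(1))
    then show ?thesis by (rule eventually_mono) auto
  qed
  then have "\<forall>\<^sub>F x in at x0 within X. \<forall>i\<in>{1..n}. x \<in> feas c {1..m} \<longrightarrow> F x0 \<le> f i x"
    by (intro eventually_ball_finite) auto
  then obtain d where d: "d > 0"
    and le: "\<And>x i. x \<in> X \<Longrightarrow> x \<noteq> x0 \<Longrightarrow> dist x x0 < d \<Longrightarrow> i \<in> {1..n} \<Longrightarrow> x \<in> feas c {1..m}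
        \<Longrightarrow> F x0 \<le> f i x"
    unfolding eventually_at by blast
  \<comment> \<open>The bounds hold on an open ball of radius \<open>d\<close>, whereas
    \<open>local_opt\<close> uses a closed ball; hence the radius \<open>d / 2\<close>. Infeasible
    points have value \<infinity>.\<close>
  have "F x0 \<le> F x" if "x \<in> X" "norm (x - x0) \<le> d / 2" for x
  proof (cases "x \<in> feas c {1..m} \<and> x \<noteq> x0")
    case True
    then obtain i where "i \<in> {1..n}" "F x = f i x" using F_attained by blast
    then show ?thesis using le[of x i] True that d by (simp add: dist_norm)
  qed (auto simp: Fsub_def)
  then have "F x0 = (INF x\<in>{x \<in> X. norm (x - x0) \<le> d / 2}. F x)"
    using x0 d by (intro antisym INF_greatest INF_lower) auto
  then show ?thesis
    unfolding local_opt_def using x0 d fin by (auto intro!: exI[of _ "d / 2"])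
qed

end

section \<open>Invariant and potential of the program\<close>

locale ulo = ulo_problem n m X f c xs
  for n m and X :: "'a::real_normed_vector set" and f c xs +
  fixes \<rho> epst eps :: real
  assumes rho_nonneg: "\<rho> \<ge> 0" and eps_nonneg: "eps \<ge> 0"
begin

definition incumbent :: "'a \<Rightarrow> ereal \<Rightarrow> bool" where
  "incumbent x Fh \<longleftrightarrow> x \<in> X \<and> x \<in> feas c {1..m} \<and> Fh = F x \<and> local_opt X F x"

text \<open>The inclusion keeps every active piece processed or waiting in \<open>st_V s\<close>, so
  an empty \<open>st_V s\<close> means that all are processed. The bound by \<open>st_R s\<close>
  leaves out the pieces of \<open>st_H s\<close>, which \<open>common_inv\<close> bounds by
  \<open>st_Fhat s\<close>.\<close>

definition phaseA_local :: "'a ulo_state \<Rightarrow> bool" where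
  "phaseA_local s \<longleftrightarrow> st_xbar s \<in> X \<and> st_xbar s \<in> feas c {1..m} \<and> st_R s = F (st_xbar s)
     \<and> rho_active n f \<rho> (st_xbar s) \<subseteq> st_Hp s \<union> st_V s
     \<and> (\<forall>i\<in>st_Hp s - st_H s. st_R s \<le> piece_min i) \<and> card (st_H s) < card (st_Hp s)"

definition common_inv :: "'a ulo_state \<Rightarrow> bool" where
  "common_inv s \<longleftrightarrow> st_H s \<subseteq> {1..n} \<and> st_S s \<subseteq> {1..m} \<and> st_i s \<in> {1..n}
     \<and> (\<forall>i\<in>st_H s. st_Fhat s \<le> piece_min i) \<and> st_Fchk s \<le> Fstar"

text \<open>The two cardinality bounds lead to the two bounds on the number of iterations. Before
  the first iteration \<open>st_x s\<close> is arbitrary, so nothing is claimed about it.\<close>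

definition main_inv :: "'a ulo_state \<Rightarrow> bool" where
  "main_inv s \<longleftrightarrow> st_k s \<le> card (st_H s) \<and> st_k s \<le> card (st_S s) \<and>
     (if st_k s = 0 then st_Fhat s = \<infinity> else incumbent (st_x s) (st_Fhat s))"

text \<open>In phase (a), \<open>st_R s = \<infinity>\<close> holds exactly before the first pass through the loop.\<close>

definition loc_inv :: "'a ulo_state \<Rightarrow> bool" where
  "loc_inv s \<longleftrightarrow> (case st_loc s of
     LoopTest \<Rightarrow> main_inv s \<and> st_i s \<notin> st_H s \<and> (st_S s = {1..m} \<longrightarrow> piece_min (st_i s) \<le> Fstar)
   | PhaseA \<Rightarrow> main_inv s \<and> st_H s \<subseteq> st_Hp s \<and> st_Hp s \<subseteq> {1..n} \<and> st_V s \<subseteq> {1..n}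
       \<and> st_V s \<inter> st_Hp s = {}
       \<and> (if st_R s = \<infinity>
          then st_Hp s = st_H s \<and> st_V s = {st_i s}
            \<and> (st_S s = {1..m} \<longrightarrow> piece_min (st_i s) \<le> Fstar)
          else phaseA_local s \<and> (st_S s = {1..m} \<longrightarrow> st_R s \<le> Fstar))
   | PhaseB \<Rightarrow> st_k s < card (st_H s) \<and> st_k s \<le> card (st_S s) \<and> incumbent (st_x s) (st_Fhat s)
       \<and> (st_S s = {1..m} \<longrightarrow> st_Fhat s \<le> Fstar)
   | Returned \<Rightarrow> incumbent (st_x s) (st_Fhat s) \<and> st_k s \<le> min n (m + 1)
       \<and> st_Fhat s - Fstar \<le> max (ereal eps) (max 1 \<bar>st_Fhat s\<bar> * ereal epst))"

definition inv :: "'a ulo_state \<Rightarrow> bool" where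
  "inv s \<longleftrightarrow> common_inv s \<and> loc_inv s"

text \<open>Each iteration processes a new piece; the 4 units this frees pay for its changes of location.\<close>

definition potential :: "'a ulo_state \<Rightarrow> nat" where
  "potential s = (case st_loc s of
     LoopTest \<Rightarrow> 4 * (n - card (st_H s))
   | PhaseA \<Rightarrow> if st_R s = \<infinity> then 4 * (n - card (st_H s)) - 1 else 4 * (n - card (st_Hp s)) + 2
   | PhaseB \<Rightarrow> 4 * (n - card (st_H s)) + 1
   | Returned \<Rightarrow> 0)"

section \<open>Preservation of the invariant and decrease of the potential\<close>

lemma card_piece_less: "H \<subseteq> {1..n} \<Longrightarrow> i \<in> {1..n} \<Longrightarrow> i \<notin> H \<Longrightarrow> card H < n"
  by (metis card_atLeastAtMost diff_Suc_1 finite_atLeastAtMost psubsetI psubset_card_mono)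

text \<open>Since \<open>m \<ge> 1\<close>, the empty set of constraints is not
  \<open>{1..m}\<close>, so the condition on \<open>st_i s\<close> for a full \<open>st_S s\<close>
  holds vacuously.\<close>

lemma inv_init: "i0 \<in> {1..n} \<Longrightarrow> inv (ulo_init i0 x0)"
  using m_pos by (auto simp: inv_def common_inv_def loc_inv_def main_inv_def ulo_init_def)

lemma test_step:
  assumes inv: "inv s" and loc: "st_loc s = LoopTest"
  shows "inv (test_step epst eps s)" "potential (test_step epst eps s) < potential s"
proof -
  have common: "common_inv s" and main: "main_inv s" and new: "st_i s \<notin> st_H s"
    and i: "st_S s = {1..m} \<longrightarrow> piece_min (st_i s) \<le> Fstar"
    using inv loc by (auto simp: inv_def loc_inv_def)
  \<comment> \<open>The unprocessed piece \<open>st_i s\<close> keeps the truncated difference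
    \<open>n - card (st_H s)\<close> positive, so the potential really drops.\<close>
  have H: "card (st_H s) < n"
    using common new card_piece_less by (auto simp: common_inv_def)
  have S: "card (st_S s) \<le> m"
    using common card_mono[of "{1..m}" "st_S s"] by (auto simp: common_inv_def)
  show "potential (test_step epst eps s) < potential s"
    using loc H by (auto simp: potential_def test_step_def)
  show "inv (test_step epst eps s)"
  proof (cases "st_k s = 0 \<or>
         st_Fhat s - st_Fchk s > max (ereal eps) (max 1 \<bar>st_Fhat s\<bar> * ereal epst)")
    case True
    have "main_inv (test_step epst eps s)"
      using main True by (simp add: main_inv_def test_step_def)
    then show ?thesis
      using True common new i unfolding inv_def
      by (auto simp: test_step_def loc_inv_def common_inv_def)
  next
    case False
    have "st_Fhat s - Fstar \<le> st_Fhat s - st_Fchk s"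
      using common by (auto simp: common_inv_def intro: ereal_minus_mono)
    then have "st_Fhat s - Fstar \<le> max (ereal eps) (max 1 \<bar>st_Fhat s\<bar> * ereal epst)"
      using False by (meson leI order_trans)
    moreover have "incumbent (st_x s) (st_Fhat s)" "st_k s \<le> n" "st_k s \<le> m"
      using main False H S by (auto simp: main_inv_def)
    ultimately show ?thesis
      using False common unfolding inv_def
      by (auto simp: test_step_def loc_inv_def common_inv_def)
  qed
qed

text \<open>A rejected piece has a minimum of at least \<open>st_R s\<close>. An accepted piece
  \<open>i\<close> lowers \<open>st_R s\<close> to \<open>F xt \<le> piece_min i\<close>, which is
  below the old value and thus preserves the bounds of earlier pieces.\<close>

lemma phaseA_step:
  assumes inv: "inv s" and loc: "st_loc s = PhaseA"
    and draw: "\<And>A. A \<noteq> {} \<Longrightarrow> draw A \<in> A"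
  defines "s' \<equiv> phaseA_step n m X f c xs \<rho> draw s"
  shows "inv s'" "potential s' < potential s"
proof -
  have common: "common_inv s" and main: "main_inv s"
    and Hp: "st_H s \<subseteq> st_Hp s" "st_Hp s \<subseteq> {1..n}" and V: "st_V s \<subseteq> {1..n}"
      "st_V s \<inter> st_Hp s = {}"
    and start: "st_R s = \<infinity> \<Longrightarrow> st_Hp s = st_H s \<and> st_V s = {st_i s}
            \<and> (st_S s = {1..m} \<longrightarrow> piece_min (st_i s) \<le> Fstar)"
    and later: "st_R s \<noteq> \<infinity> \<Longrightarrow> phaseA_local s \<and> (st_S s = {1..m} \<longrightarrow> st_R s \<le> Fstar)"
    using inv loc by (auto simp: inv_def loc_inv_def split: if_splits)
  have "inv s' \<and> potential s' < potential s"
  proof (cases "st_V s = {}")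
    case False
    define i where "i = draw (st_V s)"
    have i: "i \<in> st_V s" "i \<in> {1..n}" "i \<notin> st_Hp s"
      using draw[OF False] V by (auto simp: i_def)
    have fin: "finite (st_Hp s)" using Hp finite_subset by blast
    have card: "card (st_Hp s) < n" using card_piece_less Hp i by blast
    have cardH: "card (st_H s) \<le> card (st_Hp s)" using fin Hp card_mono by blast
    show ?thesis
    proof (cases "piece_min i \<ge> st_R s")
      case True
      have s': "s' = s\<lparr>st_Hp := insert i (st_Hp s), st_V := st_V s - {i}\<rparr>"
        using False True by (simp add: s'_def phaseA_step_def Let_def i_def)
      \<comment> \<open>Piece minima are finite, so the first piece drawn is never rejected.\<close>
      have R: "st_R s \<noteq> \<infinity>" using True piece_min_finite[OF i(2)] by auto
      have "phaseA_local s'"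
        using later[OF R] True i fin by (auto simp: s' phaseA_local_def)
      moreover have "main_inv s'" "common_inv s'"
        using main common by (simp_all add: s' main_inv_def common_inv_def)
      ultimately have "inv s'"
        using later[OF R] R Hp V i loc by (auto simp: inv_def loc_inv_def s')
      moreover have "potential s' < potential s"
        using R i fin card loc by (simp add: potential_def s')
      ultimately show ?thesis ..
    next
      case less: False
      define xt where "xt = piece_argmin i"
      have s': "s' = s\<lparr>st_Hp := insert i (st_Hp s),
          st_V := rho_active n f \<rho> xt - insert i (st_Hp s), st_R := F xt,
          st_xbar := xt, st_istar := i\<rparr>"
        using False less by (simp add: s'_def phaseA_step_def Let_def i_def xt_def)
      have xt: "xt \<in> X" "xt \<in> feas c {1..m}" "F xt \<le> piece_min i"
        using piece_argmin_in F_piece_argmin_le i by (auto simp: xt_def)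
      have R: "F xt \<noteq> \<infinity>" using F_finite[of xt] xt by auto
      have "F xt \<le> piece_min l" if "l \<in> insert i (st_Hp s) - st_H s" for l
      proof (cases "l = i")
        case False
        then have "st_R s \<le> piece_min l"
          using that start later by (cases "st_R s = \<infinity>") (auto simp: phaseA_local_def)
        then show ?thesis using less xt by order
      qed (use xt in simp)
      then have "phaseA_local s'"
        using xt i fin cardH by (auto simp: s' phaseA_local_def)
      moreover have "main_inv s'" "common_inv s'"
        using main common by (simp_all add: s' main_inv_def common_inv_def)
      \<comment> \<open>The first piece drawn is \<open>st_i s\<close>, whose minimum is at most
        \<open>Fstar\<close> once all constraints are in force; later acceptances only lower
        \<open>st_R s\<close>.\<close>
      moreover have "F xt \<le> Fstar" if S: "st_S s = {1..m}"
      proof (cases "st_R s = \<infinity>")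
        case True
        then show ?thesis using start i S xt by auto
      next
        case False
        then show ?thesis using later S xt less by (meson leI order_trans less_imp_le)
      qed
      ultimately have "inv s'"
        using R Hp i loc by (auto simp: inv_def loc_inv_def s' rho_active_def)
      \<comment> \<open>The first pass lowers the potential by just 1, since
        \<open>st_Hp s = st_H s\<close> then; later passes lower it by 4.\<close>
      moreover have "potential s' < potential s"
        using R i fin card loc start by (auto simp: potential_def s')
      ultimately show ?thesis ..
    qed
  next
    case True
    then have R: "st_R s \<noteq> \<infinity>" using start by auto
    define x where "x = st_xbar s"
    have x: "x \<in> X" "x \<in> feas c {1..m}" "st_R s = F x" "rho_active n f \<rho> x \<subseteq> st_Hp s"
      "\<And>i. i \<in> st_Hp s - st_H s \<Longrightarrow> F x \<le> piece_min i" "card (st_H s) < card (st_Hp s)"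
      using later[OF R] True by (auto simp: phaseA_local_def x_def)
    have xS: "F x \<le> Fstar" if "st_S s = {1..m}"
      using later[OF R] that x by auto
    have fin: "\<bar>F x\<bar> \<noteq> \<infinity>" using x(1,2) by (rule F_finite)
    have k: "st_k s < card (st_Hp s)" "st_k s \<le> card (st_S s)"
      using main x by (auto simp: main_inv_def)
    show ?thesis
    proof (cases "F x < st_Fhat s")
      case less: True
      have s': "s' = s\<lparr>st_loc := PhaseB, st_H := st_Hp s, st_Fhat := F x, st_x := x\<rparr>"
        using True less by (simp add: s'_def phaseA_step_def x_def)
      \<comment> \<open>A piece active at \<open>x\<close> may have been processed in an earlier
        iteration; then it is bounded by the old \<open>st_Fhat s\<close>, which exceeds
        \<open>F x\<close>.\<close>
      have le: "F x \<le> piece_min i" if "i \<in> st_Hp s" for i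
      proof (cases "i \<in> st_H s")
        case True
        then have "st_Fhat s \<le> piece_min i" using common by (auto simp: common_inv_def)
        then show ?thesis using less by order
      qed (use that x in auto)
      then have "local_opt X F x"
        using x rho_nonneg by (intro local_opt_if_active_ge) auto
      then have "incumbent (st_x s') (st_Fhat s')" using x by (simp add: s' incumbent_def)
      moreover have "common_inv s'" using le common Hp by (simp add: s' common_inv_def)
      ultimately have "inv s'" using k xS by (simp add: inv_def loc_inv_def s')
      then show ?thesis using loc R by (simp add: potential_def s')
    next
      case ge: False
      have s': "s' = s\<lparr>st_loc := PhaseB, st_H := st_Hp s\<rparr>"
        using True ge by (simp add: s'_def phaseA_step_def x_def)
      \<comment> \<open>As \<open>F x\<close> is finite and no improvement, \<open>st_Fhat s\<close>
        is not \<infinity>; so this is not the first iteration and an incumbent exists.\<close>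
      have "incumbent (st_x s) (st_Fhat s)"
        using main ge fin by (auto simp: main_inv_def split: if_splits)
      then have "incumbent (st_x s') (st_Fhat s')" by (simp add: s')
      moreover have "st_Fhat s \<le> piece_min i" if "i \<in> st_Hp s" for i
        using that common x(5)[of i] ge by (cases "i \<in> st_H s") (auto simp: common_inv_def)
      then have "common_inv s'" using common Hp by (simp add: s' common_inv_def)
      moreover have "st_Fhat s \<le> Fstar" if "st_S s = {1..m}" using xS[OF that] ge by order
      ultimately have "inv s'" using k by (simp add: inv_def loc_inv_def s')
      then show ?thesis using loc R by (simp add: potential_def s')
    qed
  qed
  then show "inv s'" "potential s' < potential s" by auto
qed

text \<open>The drawn index lies outside \<open>st_S s\<close>, so the set grows even if the active
  constraints add nothing.\<close>

lemma S_plus: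
  assumes S: "st_S s \<subseteq> {1..m}" and draw: "\<And>A. A \<noteq> {} \<Longrightarrow> draw A \<in> A"
  shows "S_plus m c xs draw s \<subseteq> {1..m}"
    and "st_S s \<noteq> {1..m} \<Longrightarrow> card (st_S s) < card (S_plus m c xs draw s)"
proof -
  show sub: "S_plus m c xs draw s \<subseteq> {1..m}"
    using S draw[of "{1..m} - st_S s"] by (auto simp: S_plus_def active_constraints_def)
  assume ne: "st_S s \<noteq> {1..m}"
  then have "draw ({1..m} - st_S s) \<notin> st_S s" using draw[of "{1..m} - st_S s"] S by auto
  with ne have "st_S s \<subset> S_plus m c xs draw s" by (auto simp: S_plus_def)
  then show "card (st_S s) < card (S_plus m c xs draw s)"
    using sub finite_subset psubset_card_mono by blast
qed

text \<open>The values \<open>val\<close> underestimate the piece minima, whence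
  \<open>Fchk \<le> Fstar \<le> st_Fhat s\<close>. If the gap stays open, the chosen piece is
  unprocessed, and for \<open>Sp = {1..m}\<close> its estimate is its true minimum.\<close>

lemma phaseB_step:
  assumes inv: "inv s" and loc: "st_loc s = PhaseB"
    and draw: "\<And>A. A \<noteq> {} \<Longrightarrow> draw A \<in> A" and tie: "\<And>A. A \<noteq> {} \<Longrightarrow> tie A \<in> A"
  defines "s' \<equiv> phaseB_step n m X f c xs draw tie s"
  shows "inv s'" "potential s' < potential s"
proof -
  have common: "common_inv s" and k: "st_k s < card (st_H s)" "st_k s \<le> card (st_S s)"
    and inc: "incumbent (st_x s) (st_Fhat s)" and S: "st_S s = {1..m} \<longrightarrow> st_Fhat s \<le> Fstar"
    using inv loc by (auto simp: inv_def loc_inv_def)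
  have HS: "st_H s \<subseteq> {1..n}" "st_S s \<subseteq> {1..m}" using common by (auto simp: common_inv_def)
  then have card: "card (st_H s) \<le> n" "card (st_S s) \<le> m"
    using card_mono[of "{1..n}" "st_H s"] card_mono[of "{1..m}" "st_S s"] by auto
  define Sp where "Sp = S_plus m c xs draw s"
  define val where "val = (\<lambda>i. if i \<in> st_H s then piece_min i else nu X f c {i} Sp)"
  define i where "i = tie {i. is_arg_min val (\<lambda>l. l \<in> {1..n}) i}"
  define Fchk where "Fchk = max (st_Fchk s) (val i)"
  have s': "s' = s\<lparr>st_loc := (if Fchk = st_Fhat s then Returned else LoopTest),
           st_k := Suc (st_k s), st_i := i, st_S := Sp, st_Fchk := Fchk\<rparr>"
    unfolding s'_def phaseB_step_def Let_def Fchk_def i_def val_def Sp_def ..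
  have Sp: "Sp \<subseteq> {1..m}" "st_S s \<noteq> {1..m} \<Longrightarrow> card (st_S s) < card Sp"
    using S_plus[of s draw] HS draw by (auto simp: Sp_def)
  have "\<exists>i. is_arg_min val (\<lambda>l. l \<in> {1..n}) i"
    using ex_is_arg_min_if_finite[of "{1..n}" val] n_pos by (auto simp: is_arg_min_def)
  then have "is_arg_min val (\<lambda>l. l \<in> {1..n}) i"
    using tie[of "{i. is_arg_min val (\<lambda>l. l \<in> {1..n}) i}"] by (auto simp: i_def)
  then have i: "i \<in> {1..n}" "\<And>l. l \<in> {1..n} \<Longrightarrow> val i \<le> val l"
    by (auto simp: is_arg_min_def not_less)
  have val_le: "val l \<le> piece_min l" for l
    using nu_singleton_mono[OF Sp(1)] by (simp add: val_def)
  obtain l where "l \<in> {1..n}" "piece_min l \<le> Fstar" using Fstar_attained by blast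
  then have "val i \<le> Fstar" using i(2) val_le by (meson order_trans)
  then have Fchk: "Fchk \<le> Fstar" using common by (simp add: Fchk_def common_inv_def)
  have x: "st_x s \<in> X" "st_x s \<in> feas c {1..m}" "st_Fhat s = F (st_x s)"
    using inc by (auto simp: incumbent_def)
  have Fhat: "Fstar \<le> st_Fhat s" "\<bar>st_Fhat s\<bar> \<noteq> \<infinity>" using x Fstar_le F_finite by auto
  have common': "common_inv s'" using common Fchk i Sp by (simp add: s' common_inv_def)
  have inc': "incumbent (st_x s') (st_Fhat s')" using inc by (simp add: s')
  show "inv s'"
  proof (cases "Fchk = st_Fhat s")
    case True
    then have "st_Fhat s = Fstar" using Fchk Fhat by order
    then have "st_Fhat s - Fstar = 0" using Fhat by simp
    moreover have "0 \<le> ereal eps" using eps_nonneg by simp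
    \<comment> \<open>The extra 1 in \<open>m + 1\<close> arises here: \<open>st_k s\<close> is at
      most \<open>card (st_S s) \<le> m\<close> before it is incremented.\<close>
    ultimately show ?thesis
      using common' inc' True k card by (auto simp: inv_def loc_inv_def s' le_max_iff_disj)
  next
    case False
    have new: "i \<notin> st_H s"
    proof
      assume "i \<in> st_H s"
      then have "st_Fhat s \<le> Fchk"
        using common by (auto simp: Fchk_def val_def common_inv_def le_max_iff_disj)
      then show False using False Fchk Fhat by order
    qed
    have full: "val i = piece_min i" if "Sp = {1..m}" using that by (simp add: val_def)
    \<comment> \<open>A full \<open>st_S s\<close> would give
      \<open>st_Fhat s \<le> Fstar \<le> Fchk\<close> and close the gap. So \<open>st_S s\<close>
      grows and pays for the increment of \<open>st_k s\<close>.\<close>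
    have "st_S s \<noteq> {1..m}"
    proof
      assume *: "st_S s = {1..m}"
      then have "Sp = {1..m}" by (simp add: Sp_def S_plus_def)
      then have "Fstar \<le> Fchk"
        using full Fstar_le_piece_min[OF i(1)] by (simp add: Fchk_def le_max_iff_disj)
      then show False using False Fchk Fhat S * by auto
    qed
    then have "Suc (st_k s) \<le> card Sp" using Sp k by simp
    then have "main_inv s'" using inc' k by (simp add: main_inv_def s')
    moreover have "piece_min i \<le> Fstar" if "Sp = {1..m}"
      using full[OF that] \<open>val i \<le> Fstar\<close> by simp
    ultimately show ?thesis
      using common' False new by (simp add: inv_def loc_inv_def s')
  qed
  show "potential s' < potential s" using loc by (simp add: potential_def s')
qed

lemma ulo_step:
  assumes "inv s" "\<And>A. A \<noteq> {} \<Longrightarrow> draw A \<in> A" "\<And>A. A \<noteq> {} \<Longrightarrow> tie A \<in> A"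
  defines "s' \<equiv> ulo_step n m X f c xs \<rho> epst eps draw tie s"
  shows "inv s'" "st_loc s \<noteq> Returned \<Longrightarrow> potential s' < potential s"
  using test_step[of s] phaseA_step[of s draw] phaseB_step[of s draw tie] assms
  by (auto simp: ulo_step_def split: ulo_loc.split)

section \<open>Runs under a fixed realization of the choices\<close>

context
  fixes draw tie :: "nat \<Rightarrow> nat set \<Rightarrow> nat" and i0 :: nat and x0 :: 'a
  assumes draw: "choice_seq draw" and tie: "choice_seq tie" and i0: "i0 \<in> {1..n}"
begin

abbreviation run :: "nat \<Rightarrow> 'a ulo_state" where
  "run \<equiv> ulo_run n m X f c xs \<rho> epst eps draw tie i0 x0"

lemma inv_run: "inv (run t)"
  by (induction t) (use draw tie i0 inv_init ulo_step(1) in \<open>auto simp: choice_seq_def\<close>)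

text \<open>After \<open>t\<close> steps without return at least \<open>t\<close> units of the
  initial potential are used up.\<close>

lemma run_terminates: "\<exists>T. st_loc (run T) = Returned"
proof (rule ccontr)
  assume "\<not> ?thesis"
  then have less: "potential (run (Suc t)) < potential (run t)" for t
    using ulo_step(2)[OF inv_run] draw tie by (simp add: choice_seq_def)
  have "potential (run t) + t \<le> potential (run 0)" for t
  proof (induction t)
    case (Suc t)
    then show ?case using less[of t] by linarith
  qed simp
  from this[of "Suc (potential (run 0))"] show False by linarith
qed

lemma run_stays: "st_loc (run T) = Returned \<Longrightarrow> run (T + t) = run T"
  by (induction t) (auto simp: ulo_step_def)

text \<open>No query is made after the return, so all calls carry one of finitely many times, and a
  single step makes finitely many queries.\<close>

lemma finite_oracle_calls: "finite (oracle_calls n m c xs draw run k)"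
proof -
  obtain T where T: "st_loc (run T) = Returned" using run_terminates by blast
  have "oracle_queries n m c xs (draw t) (run t) = {}" if "t \<ge> T" for t
    using run_stays[OF T, of "t - T"] T that by (simp add: oracle_queries_def)
  then have "oracle_calls n m c xs draw run k
      \<subseteq> Sigma {..<T} (\<lambda>t. oracle_queries n m c xs (draw t) (run t))"
    unfolding oracle_calls_def by (auto simp: not_less[symmetric])
  moreover have "finite (oracle_queries n m c xs (draw t) (run t))" for t
    unfolding oracle_queries_def Setcompr_eq_image by (auto split: ulo_loc.split)
  ultimately show ?thesis by (meson finite_SigmaI finite_lessThan finite_subset)
qed

text \<open>At the return, \<open>incumbent\<close> identifies \<open>st_Fhat\<close> with the value
  of \<open>F\<close> at the returned point, which turns the bounds of \<open>loc_inv\<close> into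
  the claims.\<close>

lemma run_result:
  obtains T where "st_loc (run T) = Returned" "st_x (run T) \<in> X"
    "F (st_x (run T)) - Fstar \<le> max (ereal eps) (max 1 \<bar>F (st_x (run T))\<bar> * ereal epst)"
    "st_k (run T) \<le> min n (m + 1)" "local_opt X F (st_x (run T))"
proof -
  obtain T where T: "st_loc (run T) = Returned" using run_terminates by blast
  then have "loc_inv (run T)" using inv_run by (simp add: inv_def)
  with T show ?thesis by (intro that[of T]) (auto simp: loc_inv_def incumbent_def)
qed

end

end

theorem theorem3p2:
  fixes n m :: nat and X :: "(real ^ 'd) set"
    and f :: "nat \<Rightarrow> real ^ 'd \<Rightarrow> ereal" and c :: "nat \<Rightarrow> real ^ 'd \<Rightarrow> real"
    and xs :: "nat set \<Rightarrow> nat set \<Rightarrow> real ^ 'd"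
    and \<rho> epst eps :: real
    and draw tie :: "nat \<Rightarrow> nat set \<Rightarrow> nat"
    and i0 :: nat and x0 :: "real ^ 'd"
  defines "F \<equiv> Fsub f c {1..n} {1..m}"
    and "Fstar \<equiv> nu X f c {1..n} {1..m}"
    and "\<sigma> \<equiv> ulo_run n m X f c xs \<rho> epst eps draw tie i0 x0"
  assumes "n \<ge> 1" and "m \<ge> 1"
    and "\<forall>i\<in>{1..n}. \<forall>x. f i x \<noteq> -\<infinity>"
    and "-\<infinity> < Fstar" and "Fstar < \<infinity>"
    and "is_oracle n m X f c xs"
    and "\<forall>i\<in>{1..n}. continuous_on (edom (f i)) (f i)"
    and "\<forall>i\<in>{1..n}. convex_on (edom (f i)) (\<lambda>x. real_of_ereal (f i x))"
    and "\<forall>i\<in>{1..n}. X \<subseteq> edom (f i)"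
    and "\<rho> \<ge> 0" and "epst \<ge> 0" and "eps \<ge> 0"
    and "i0 \<in> {1..n}"
    and "choice_seq draw" and "choice_seq tie"
  shows "(\<exists>T K xK. st_loc (\<sigma> T) = Returned \<and> st_k (\<sigma> T) = K \<and> st_x (\<sigma> T) = xK \<and>
            xK \<in> X \<and>
            F xK - Fstar \<le> max (ereal eps) (max 1 \<bar>F xK\<bar> * ereal epst) \<and>
            K \<le> min n (m + 1) \<and>
            local_opt X F xK) \<and>
         (\<forall>k. finite (oracle_calls n m c xs draw \<sigma> k))"
proof -
  interpret ulo n m X f c xs \<rho> epst eps
    by unfold_locales (use assms in auto)
  note run = \<open>choice_seq draw\<close> \<open>choice_seq tie\<close> \<open>i0 \<in> {1..n}\<close>
  show ?thesis
    unfolding F_def Fstar_def \<sigma>_def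
    using run_result[OF run] finite_oracle_calls[OF run] by metis
qed

end
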